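(* Let $G$ be any group, and let $G'$ be its commutator subgroup. If the commutator length $cl_G$ is unbounded on $G'$, then $G$ is unbounded.
   Context: For $g\in G'$, the commutator length $cl_G(g)$ is the minimal number $N$ such that $g$ is a product of $N$ simple commutators $[a,b]=aba^{-1}b^{-1}$ with $a,b\in G$. A conjugation-invariant norm on a group $G$ is a function $\nu:G\to[0,+\infty)$ such that $\nu(1)=0$; $\nu(f)=\nu(f^{-1})$; $\nu(fg)\le\nu(f)+\nu(g)$; $\nu(gfg^{-1})=\nu(f)$ for all $f,g\in G$; and $\nu(f)>0$ for all $f\ne1$. A group is bounded if it has finite diameter with respect to every bi-invariant metric, equivalently if every conjugation-invariant norm on it is a bounded function; it is unbounded otherwise. *)

theory Defs
  imports "HOL-Algebra.Generated_Groups" "HOL-Analysis.Abstract_Metric_Spaces"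
begin

text \<open>
  The library's \<open>derived_set G (carrier G)\<close> is the set of simple commutators
  \<open>a \<otimes> b \<otimes> inv a \<otimes> inv b\<close> of \<open>G\<close>, and \<open>derived G (carrier G)\<close>, the subgroup it generates,
  is the commutator subgroup.
\<close>

definition commutator_products :: "('a, 'b) monoid_scheme \<Rightarrow> nat \<Rightarrow> 'a set" where
  "commutator_products G n =
     {foldr (\<otimes>\<^bsub>G\<^esub>) cs \<one>\<^bsub>G\<^esub> | cs. length cs = n \<and> set cs \<subseteq> derived_set G (carrier G)}"

text \<open>
  Only meaningful on the commutator subgroup, where the minimum is attained
  (\<open>derived_eq_commutator_products\<close> below); the identity has commutator length \<open>0\<close>
  (empty product).
\<close>
definition commutator_length :: "('a, 'b) monoid_scheme \<Rightarrow> 'a \<Rightarrow> nat" where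
  "commutator_length G g = (LEAST n. g \<in> commutator_products G n)"

definition conj_inv_norm :: "('a, 'b) monoid_scheme \<Rightarrow> ('a \<Rightarrow> real) \<Rightarrow> bool" where
  "conj_inv_norm G \<nu> \<longleftrightarrow>
     (\<forall>f\<in>carrier G. 0 \<le> \<nu> f) \<and>
     \<nu> \<one>\<^bsub>G\<^esub> = 0 \<and>
     (\<forall>f\<in>carrier G. \<nu> (inv\<^bsub>G\<^esub> f) = \<nu> f) \<and>
     (\<forall>f\<in>carrier G. \<forall>g\<in>carrier G. \<nu> (f \<otimes>\<^bsub>G\<^esub> g) \<le> \<nu> f + \<nu> g) \<and>
     (\<forall>f\<in>carrier G. \<forall>g\<in>carrier G. \<nu> (g \<otimes>\<^bsub>G\<^esub> f \<otimes>\<^bsub>G\<^esub> inv\<^bsub>G\<^esub> g) = \<nu> f) \<and>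
     (\<forall>f\<in>carrier G. f \<noteq> \<one>\<^bsub>G\<^esub> \<longrightarrow> 0 < \<nu> f)"

definition bi_invariant_metric :: "('a, 'b) monoid_scheme \<Rightarrow> ('a \<Rightarrow> 'a \<Rightarrow> real) \<Rightarrow> bool" where
  "bi_invariant_metric G d \<longleftrightarrow>
     Metric_space (carrier G) d \<and>
     (\<forall>x\<in>carrier G. \<forall>y\<in>carrier G. \<forall>g\<in>carrier G.
        d (g \<otimes>\<^bsub>G\<^esub> x) (g \<otimes>\<^bsub>G\<^esub> y) = d x y \<and> d (x \<otimes>\<^bsub>G\<^esub> g) (y \<otimes>\<^bsub>G\<^esub> g) = d x y)"

text \<open>The equivalence with boundedness of all conjugation-invariant norms is
  \<open>bounded_group_iff_norm\<close> below.\<close>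
definition bounded_group :: "('a, 'b) monoid_scheme \<Rightarrow> bool" where
  "bounded_group G \<longleftrightarrow>
     (\<forall>d. bi_invariant_metric G d \<longrightarrow> Metric_space.mbounded (carrier G) d (carrier G))"

lemma (in group) foldr_mult_append:
  assumes "set xs \<subseteq> carrier G" "set ys \<subseteq> carrier G"
  shows "foldr (\<otimes>) (xs @ ys) \<one> = foldr (\<otimes>) xs \<one> \<otimes> foldr (\<otimes>) ys \<one>"
proof -
  have closed: "foldr (\<otimes>) zs \<one> \<in> carrier G" if "set zs \<subseteq> carrier G" for zs
    using that by (induction zs) auto
  show ?thesis
    using assms closed by (induction xs) (auto simp: m_assoc)
qed

lemma (in group) derived_eq_commutator_products:
  "derived G (carrier G) = (\<Union>n. commutator_products G n)"
proof
  define D where "D = derived_set G (carrier G)"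
  have D_iff: "h \<in> D \<longleftrightarrow> (\<exists>a\<in>carrier G. \<exists>b\<in>carrier G. h = a \<otimes> b \<otimes> inv a \<otimes> inv b)" for h
    by (simp add: D_def)
  have D: "D \<subseteq> carrier G" by (auto simp: D_iff)
  have products: "commutator_products G n = {foldr (\<otimes>) cs \<one> | cs. length cs = n \<and> set cs \<subseteq> D}" for n
    by (simp only: commutator_products_def D_def)
  have derived: "derived G (carrier G) = generate G D"
    by (simp only: derived_def D_def)
  have inv_D: "inv h \<in> D" if h: "h \<in> D" for h
  proof -
    obtain a b where ab: "a \<in> carrier G" "b \<in> carrier G" "h = a \<otimes> b \<otimes> inv a \<otimes> inv b"
      using h unfolding D_iff by blast
    then have "inv h = b \<otimes> a \<otimes> inv b \<otimes> inv a"
      by (simp add: inv_mult_group m_assoc)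
    with ab show ?thesis unfolding D_iff by blast
  qed
  have single: "h \<in> (\<Union>n. commutator_products G n)" if "h \<in> D" for h
  proof -
    have "h = foldr (\<otimes>) [h] \<one>" using that D by auto
    with that have "h \<in> commutator_products G 1"
      unfolding products by (intro CollectI exI[of _ "[h]"]) auto
    then show ?thesis by blast
  qed
  show "derived G (carrier G) \<subseteq> (\<Union>n. commutator_products G n)"
  proof
    fix g assume "g \<in> derived G (carrier G)"
    then show "g \<in> (\<Union>n. commutator_products G n)"
      unfolding derived
    proof (induction rule: generate.induct)
      case one
      have "\<one> \<in> commutator_products G 0" by (simp add: products)
      then show ?case by blast
    next
      case (incl h) then show ?case by (rule single)
    next
      case (inv h) then show ?case by (intro single inv_D)
    next
      case (eng h1 h2)
      then obtain xs ys where
        "set xs \<subseteq> D" "h1 = foldr (\<otimes>) xs \<one>" "set ys \<subseteq> D" "h2 = foldr (\<otimes>) ys \<one>"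
        unfolding products by auto
      moreover from this have "foldr (\<otimes>) (xs @ ys) \<one> = foldr (\<otimes>) xs \<one> \<otimes> foldr (\<otimes>) ys \<one>"
        by (intro foldr_mult_append subset_trans[OF _ D])
      moreover have "set (xs @ ys) \<subseteq> D"
        using calculation by simp
      ultimately have "h1 \<otimes> h2 \<in> commutator_products G (length (xs @ ys))"
        unfolding products mem_Collect_eq
        by (intro exI[of _ "xs @ ys"] conjI) (simp_all only:)
      then show ?case by blast
    qed
  qed
  show "(\<Union>n. commutator_products G n) \<subseteq> derived G (carrier G)"
  proof -
    have "foldr (\<otimes>) cs \<one> \<in> generate G D" if "set cs \<subseteq> D" for cs
      using that
    proof (induction cs)
      case Nil
      show ?case by (simp add: generate.one)
    next
      case (Cons c cs)
      then have "c \<in> D" "set cs \<subseteq> D" by simp_all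
      then have "c \<otimes> foldr (\<otimes>) cs \<one> \<in> generate G D"
        by (intro generate.eng generate.incl Cons.IH)
      then show ?case by simp
    qed
    then show ?thesis unfolding products derived by blast
  qed
qed

lemma (in group) bounded_group_iff_norm:
  "bounded_group G \<longleftrightarrow>
     (\<forall>\<nu>. conj_inv_norm G \<nu> \<longrightarrow> (\<exists>C. \<forall>g\<in>carrier G. \<nu> g \<le> C))"
proof
  assume bdd: "bounded_group G"
  show "\<forall>\<nu>. conj_inv_norm G \<nu> \<longrightarrow> (\<exists>C. \<forall>g\<in>carrier G. \<nu> g \<le> C)"
  proof (intro allI impI)
    fix \<nu> assume nu: "conj_inv_norm G \<nu>"
    define d where "d x y = (if x \<in> carrier G \<and> y \<in> carrier G then \<nu> (x \<otimes> inv y) else 0)" for x y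
    have ms: "Metric_space (carrier G) d"
    proof
      show "0 \<le> d x y" for x y
        using nu by (auto simp: d_def conj_inv_norm_def)
      show "d x y = d y x" for x y
      proof (cases "x \<in> carrier G \<and> y \<in> carrier G")
        case True
        then have "inv (x \<otimes> inv y) = y \<otimes> inv x" by (simp add: inv_mult_group)
        moreover have "\<nu> (inv (x \<otimes> inv y)) = \<nu> (x \<otimes> inv y)"
          using nu True by (simp add: conj_inv_norm_def)
        ultimately show ?thesis using True by (simp add: d_def)
      qed (auto simp: d_def)
      show "d x y = 0 \<longleftrightarrow> x = y" if xy: "x \<in> carrier G" "y \<in> carrier G" for x y
      proof -
        have "x \<otimes> inv y = \<one> \<longleftrightarrow> x = y"
          using xy by (metis inv_closed inv_equality inv_inv r_inv)
        moreover have "\<nu> f = 0 \<longleftrightarrow> f = \<one>" if "f \<in> carrier G" for f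
          using nu that unfolding conj_inv_norm_def by (metis less_irrefl)
        ultimately show ?thesis using xy by (simp add: d_def)
      qed
      show "d x z \<le> d x y + d y z"
        if xyz: "x \<in> carrier G" "y \<in> carrier G" "z \<in> carrier G" for x y z
      proof -
        have "inv y \<otimes> (y \<otimes> inv z) = inv z"
          using xyz by (simp flip: m_assoc)
        then have "(x \<otimes> inv y) \<otimes> (y \<otimes> inv z) = x \<otimes> inv z"
          using xyz by (simp add: m_assoc)
        moreover have "\<nu> ((x \<otimes> inv y) \<otimes> (y \<otimes> inv z)) \<le> \<nu> (x \<otimes> inv y) + \<nu> (y \<otimes> inv z)"
          using nu xyz by (simp add: conj_inv_norm_def)
        ultimately show ?thesis using xyz by (simp add: d_def)
      qed
    qed
    have "bi_invariant_metric G d"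
      unfolding bi_invariant_metric_def
    proof (intro conjI ballI ms)
      fix x y g assume xyg: "x \<in> carrier G" "y \<in> carrier G" "g \<in> carrier G"
      have "(g \<otimes> x) \<otimes> inv (g \<otimes> y) = g \<otimes> (x \<otimes> inv y) \<otimes> inv g"
        using xyg by (simp add: inv_mult_group m_assoc)
      moreover have "\<nu> (g \<otimes> (x \<otimes> inv y) \<otimes> inv g) = \<nu> (x \<otimes> inv y)"
        using nu xyg by (simp add: conj_inv_norm_def)
      ultimately show "d (g \<otimes> x) (g \<otimes> y) = d x y" using xyg by (simp add: d_def)
      have "g \<otimes> (inv g \<otimes> inv y) = inv y"
        using xyg by (simp flip: m_assoc)
      then have "(x \<otimes> g) \<otimes> inv (y \<otimes> g) = x \<otimes> inv y"
        using xyg by (simp add: inv_mult_group m_assoc)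
      then show "d (x \<otimes> g) (y \<otimes> g) = d x y" using xyg by (simp add: d_def)
    qed
    then have "Metric_space.mbounded (carrier G) d (carrier G)"
      using bdd unfolding bounded_group_def by blast
    then obtain B where B: "\<forall>x\<in>carrier G. \<forall>y\<in>carrier G. d x y \<le> B"
      using Metric_space.mbounded_alt[OF ms] by blast
    have "\<nu> g \<le> B" if "g \<in> carrier G" for g
      using B[rule_format, of g \<one>] that by (simp add: d_def)
    then show "\<exists>C. \<forall>g\<in>carrier G. \<nu> g \<le> C" by blast
  qed
next
  assume bdd: "\<forall>\<nu>. conj_inv_norm G \<nu> \<longrightarrow> (\<exists>C. \<forall>g\<in>carrier G. \<nu> g \<le> C)"
  show "bounded_group G"
    unfolding bounded_group_def
  proof (intro allI impI)
    fix d assume d: "bi_invariant_metric G d"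
    then interpret M: Metric_space "carrier G" d
      by (simp add: bi_invariant_metric_def)
    have L: "d (g \<otimes> x) (g \<otimes> y) = d x y" and R: "d (x \<otimes> g) (y \<otimes> g) = d x y"
      if "x \<in> carrier G" "y \<in> carrier G" "g \<in> carrier G" for x y g
      using d that by (auto simp: bi_invariant_metric_def)
    have "conj_inv_norm G (\<lambda>g. d g \<one>)"
      unfolding conj_inv_norm_def
    proof (intro conjI ballI impI)
      fix f assume f: "f \<in> carrier G"
      show "d (inv f) \<one> = d f \<one>"
        using L[of "inv f" \<one> f] f by (simp add: M.commute)
      show "f \<noteq> \<one> \<Longrightarrow> 0 < d f \<one>" using f by simp
      fix g assume g: "g \<in> carrier G"
      show "d (f \<otimes> g) \<one> \<le> d f \<one> + d g \<one>"
        using M.triangle[of "f \<otimes> g" g \<one>] R[of f \<one> g] f g by simp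
      show "d (g \<otimes> f \<otimes> inv g) \<one> = d f \<one>"
        using R[of "g \<otimes> f" g "inv g"] L[of f \<one> g] f g by simp
    qed simp_all
    then obtain C where C: "\<forall>g\<in>carrier G. d g \<one> \<le> C" using bdd by blast
    then show "M.mbounded (carrier G)"
      unfolding M.mbounded by (metis M.commute one_closed)
  qed
qed

end

theory Submission
  imports Defs
begin

text \<open>
  The commutator length extends to a conjugation-invariant norm on all of \<open>G\<close>, up to an additive
  constant, and such an extension is unbounded as soon as the commutator length is.

  A norm that takes values in the natural numbers is encoded by its balls, that is, by a filtration
  whose level \<open>n\<close> consists of the elements of norm at most \<open>n\<close>.  Products of \<open>n\<close> commutators
  form such a filtration of the commutator subgroup.  Consider all filtrations of subgroups of
  \<open>G\<close> that contain the simple commutators at level \<open>1\<close> and in which an element of the commutator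
  subgroup that occurs at level \<open>n\<close> has commutator length at most \<open>n\<close>; on the commutator subgroup
  they agree with the commutator length.  The conditions involve finitely many elements at a time,
  so they survive unions of chains, and Zorn's lemma yields a maximal such filtration.

  A maximal filtration exhausts \<open>G\<close>, because any element \<open>x\<close> can be added to a filtration
  (\<open>exists_extension_containing\<close>).  The danger is that some power of \<open>x\<close> already lies in the
  support at a high level, so that a cheap \<open>x\<close> would make elements of the commutator subgroup too
  short.  But the exponents \<open>i\<close> for which \<open>x\<^sup>i\<close> lies in the support form a cyclic group, and hence
  the level of \<open>x\<^sup>i\<close> grows at most linearly in \<open>\<bar>i\<bar>\<close> (\<open>linear_level_of_powers\<close>); making \<open>x\<close>
  expensive enough avoids the danger.  Conjugating \<open>x\<close> multiplies it by one commutator only, so the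
  invariance under conjugation costs one further unit.
\<close>

section \<open>Products of commutators\<close>

context group
begin

text \<open>
  The same set as \<open>derived_set G (carrier G)\<close>, which abbreviates a nested union; a constant of its
  own is opaque to simplification.
\<close>

definition simple_commutators :: "'a set" where
  "simple_commutators = derived_set G (carrier G)"

lemma simple_commutator_iff:
  "h \<in> simple_commutators \<longleftrightarrow>
     (\<exists>a\<in>carrier G. \<exists>b\<in>carrier G. h = a \<otimes> b \<otimes> inv a \<otimes> inv b)"
  unfolding simple_commutators_def by simp

lemma simple_commutator_closed:
  "h \<in> simple_commutators \<Longrightarrow> h \<in> carrier G"
  unfolding simple_commutator_iff by auto

lemma inv_simple_commutator:
  assumes "h \<in> simple_commutators"
  shows "inv h \<in> simple_commutators"
proof -
  obtain a b where "a \<in> carrier G" "b \<in> carrier G" "h = a \<otimes> b \<otimes> inv a \<otimes> inv b"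
    using assms unfolding simple_commutator_iff by blast
  moreover from this have "inv h = b \<otimes> a \<otimes> inv b \<otimes> inv a"
    by (simp add: inv_mult_group m_assoc)
  ultimately show ?thesis unfolding simple_commutator_iff by blast
qed

lemma conjugate_mult:
  assumes "u \<in> carrier G" "a \<in> carrier G" "b \<in> carrier G"
  shows "u \<otimes> (a \<otimes> b) \<otimes> inv u = (u \<otimes> a \<otimes> inv u) \<otimes> (u \<otimes> b \<otimes> inv u)"
proof -
  have "inv u \<otimes> (u \<otimes> (b \<otimes> inv u)) = b \<otimes> inv u"
    using assms by (simp flip: m_assoc)
  then show ?thesis using assms by (simp add: m_assoc)
qed

lemma conjugate_inv:
  assumes "u \<in> carrier G" "a \<in> carrier G"
  shows "u \<otimes> inv a \<otimes> inv u = inv (u \<otimes> a \<otimes> inv u)"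
  using assms by (simp add: inv_mult_group m_assoc)

lemma conjugate_simple_commutator:
  assumes "u \<in> carrier G" "h \<in> simple_commutators"
  shows "u \<otimes> h \<otimes> inv u \<in> simple_commutators"
proof -
  obtain a b where ab: "a \<in> carrier G" "b \<in> carrier G" "h = a \<otimes> b \<otimes> inv a \<otimes> inv b"
    using assms unfolding simple_commutator_iff by blast
  have "u \<otimes> h \<otimes> inv u = (u \<otimes> a \<otimes> inv u) \<otimes> (u \<otimes> b \<otimes> inv u)
      \<otimes> inv (u \<otimes> a \<otimes> inv u) \<otimes> inv (u \<otimes> b \<otimes> inv u)"
    using conjugate_mult[of u "a \<otimes> b \<otimes> inv a" "inv b"] conjugate_mult[of u "a \<otimes> b" "inv a"]
      conjugate_mult[of u a b] conjugate_inv[of u a] conjugate_inv[of u b] assms(1) ab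
    by simp
  moreover have "u \<otimes> a \<otimes> inv u \<in> carrier G" "u \<otimes> b \<otimes> inv u \<in> carrier G"
    using assms(1) ab by auto
  ultimately show ?thesis unfolding simple_commutator_iff by blast
qed

lemma commutator_productsI:
  "set cs \<subseteq> simple_commutators \<Longrightarrow>
     foldr (\<otimes>) cs \<one> \<in> commutator_products G (length cs)"
  unfolding commutator_products_def simple_commutators_def by blast

lemma commutator_productsE:
  assumes "g \<in> commutator_products G n"
  obtains cs where "length cs = n" "set cs \<subseteq> simple_commutators" "g = foldr (\<otimes>) cs \<one>"
  using assms unfolding commutator_products_def simple_commutators_def by blast

lemma mult_commutator_products:
  assumes "f \<in> commutator_products G m" "g \<in> commutator_products G n"
  shows "f \<otimes> g \<in> commutator_products G (m + n)"
proof -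
  obtain xs ys where
    "length xs = m" "set xs \<subseteq> simple_commutators" "f = foldr (\<otimes>) xs \<one>"
    "length ys = n" "set ys \<subseteq> simple_commutators" "g = foldr (\<otimes>) ys \<one>"
    using assms by (elim commutator_productsE)
  moreover from this have "foldr (\<otimes>) (xs @ ys) \<one> = f \<otimes> g"
    using simple_commutator_closed foldr_mult_append[of xs ys] by (simp add: subset_iff)
  ultimately show ?thesis
    using commutator_productsI[of "xs @ ys"] by simp
qed

lemma one_commutator_products_0: "\<one> \<in> commutator_products G 0"
  using commutator_productsI[of "[]"] by simp

lemma simple_commutator_commutator_products:
  assumes "c \<in> simple_commutators"
  shows "c \<in> commutator_products G 1"
  using commutator_productsI[of "[c]"] assms simple_commutator_closed[OF assms] by simp

lemma commutator_products_induct [consumes 1, case_names zero Suc]: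
  assumes "g \<in> commutator_products G n"
    and "P 0 \<one>"
    and "\<And>n c g. c \<in> simple_commutators \<Longrightarrow> g \<in> commutator_products G n \<Longrightarrow> P n g
           \<Longrightarrow> P (Suc n) (c \<otimes> g)"
  shows "P n g"
proof -
  have "P (length cs) (foldr (\<otimes>) cs \<one>)" if "set cs \<subseteq> simple_commutators" for cs
    using that
  proof (induction cs)
    case Nil
    show ?case using assms(2) by simp
  next
    case (Cons c cs)
    then have "c \<in> simple_commutators" "set cs \<subseteq> simple_commutators"
      by simp_all
    then show ?case
      using assms(3)[OF _ commutator_productsI Cons.IH] by simp
  qed
  then show ?thesis using assms(1) by (elim commutator_productsE) blast
qed

lemma commutator_products_closed: "g \<in> commutator_products G n \<Longrightarrow> g \<in> carrier G"
  by (induction rule: commutator_products_induct) (use simple_commutator_closed in blast)+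

lemma one_commutator_products: "\<one> \<in> commutator_products G n"
proof (induction n)
  case 0
  show ?case by (rule one_commutator_products_0)
next
  case (Suc n)
  have "\<one> \<in> simple_commutators"
    unfolding simple_commutator_iff by (intro bexI[of _ \<one>]) auto
  from mult_commutator_products[OF simple_commutator_commutator_products[OF this] Suc]
  show ?case by simp
qed

lemma inv_commutator_products:
  "g \<in> commutator_products G n \<Longrightarrow> inv g \<in> commutator_products G n"
proof (induction rule: commutator_products_induct)
  case zero
  show ?case by (simp add: one_commutator_products)
next
  case (Suc n c g)
  have "inv (c \<otimes> g) = inv g \<otimes> inv c"
    using inv_mult_group[OF simple_commutator_closed[OF Suc.hyps(1)]
        commutator_products_closed[OF Suc.hyps(2)]] .
  then show ?case
    using mult_commutator_products[OF Suc.IH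
        simple_commutator_commutator_products[OF inv_simple_commutator[OF Suc.hyps(1)]]]
    by simp
qed

lemma conjugate_commutator_products:
  assumes u: "u \<in> carrier G"
  shows "g \<in> commutator_products G n \<Longrightarrow> u \<otimes> g \<otimes> inv u \<in> commutator_products G n"
proof (induction rule: commutator_products_induct)
  case zero
  show ?case using u by (simp add: one_commutator_products)
next
  case (Suc n c g)
  have "u \<otimes> (c \<otimes> g) \<otimes> inv u = (u \<otimes> c \<otimes> inv u) \<otimes> (u \<otimes> g \<otimes> inv u)"
    using conjugate_mult[OF u simple_commutator_closed[OF Suc.hyps(1)]
        commutator_products_closed[OF Suc.hyps(2)]] .
  then show ?case
    using mult_commutator_products[OF simple_commutator_commutator_products[OF
          conjugate_simple_commutator[OF u Suc.hyps(1)]] Suc.IH]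
    by simp
qed

end

section \<open>Filtrations that dominate the commutator length\<close>

text \<open>
  A pair \<open>(n, g)\<close> in \<open>F\<close> says that \<open>g\<close> lies in the ball of radius \<open>n\<close> of the norm being built.
  A set of pairs is used, instead of a partial function, because the axioms then pass to unions of
  chains.  Simple commutators are required at level \<open>1\<close> because conjugation has to be cheap when a new
  element is added.  The last axiom gives the lower bound for the norm.
\<close>

locale commutator_filtration = group G for G (structure) +
  fixes F :: "(nat \<times> 'a) set"
  assumes closed: "(n, g) \<in> F \<Longrightarrow> g \<in> carrier G"
    and one: "(n, \<one>) \<in> F"
    and mult: "(m, f) \<in> F \<Longrightarrow> (n, g) \<in> F \<Longrightarrow> (m + n, f \<otimes> g) \<in> F"
    and inverse: "(n, g) \<in> F \<Longrightarrow> (n, inv g) \<in> F"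
    and conjugate: "(n, g) \<in> F \<Longrightarrow> u \<in> carrier G \<Longrightarrow> (n, u \<otimes> g \<otimes> inv u) \<in> F"
    and commutator: "a \<in> carrier G \<Longrightarrow> b \<in> carrier G \<Longrightarrow> (1, a \<otimes> b \<otimes> inv a \<otimes> inv b) \<in> F"
    and commutator_length_le:
      "(n, g) \<in> F \<Longrightarrow> g \<in> derived G (carrier G) \<Longrightarrow> commutator_length G g \<le> n"

lemma (in group) commutator_products_filtration:
  "commutator_filtration G {(n, g). g \<in> commutator_products G n}"
proof unfold_locales
  fix a b assume "a \<in> carrier G" "b \<in> carrier G"
  then have "a \<otimes> b \<otimes> inv a \<otimes> inv b \<in> simple_commutators"
    unfolding simple_commutator_iff by blast
  then show "(1, a \<otimes> b \<otimes> inv a \<otimes> inv b) \<in> {(n, g). g \<in> commutator_products G n}"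
    using simple_commutator_commutator_products by blast
next
  fix n g assume "(n, g) \<in> {(n, g). g \<in> commutator_products G n}"
  then have g: "g \<in> commutator_products G n" by simp
  show "g \<in> carrier G" using g by (rule commutator_products_closed)
  show "commutator_length G g \<le> n" unfolding commutator_length_def using g by (rule Least_le)
  show "(n, inv g) \<in> {(n, g). g \<in> commutator_products G n}"
    using inv_commutator_products[OF g] by simp
  show "(n, u \<otimes> g \<otimes> inv u) \<in> {(n, g). g \<in> commutator_products G n}" if "u \<in> carrier G" for u
    using conjugate_commutator_products[OF that g] by simp
  fix m f assume "(m, f) \<in> {(n, g). g \<in> commutator_products G n}"
  then show "(m + n, f \<otimes> g) \<in> {(n, g). g \<in> commutator_products G n}"
    using mult_commutator_products g by simp
qed (simp add: one_commutator_products)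

context commutator_filtration
begin

lemma level_mono:
  assumes "(m, g) \<in> F" "m \<le> n"
  shows "(n, g) \<in> F"
  using mult[OF assms(1) one[of "n - m"]] assms(2) closed[OF assms(1)] by simp

lemma derived_in_support:
  assumes "g \<in> derived G (carrier G)"
  shows "\<exists>n. (n, g) \<in> F"
  using assms unfolding derived_def
proof (induction rule: generate.induct)
  case one
  show ?case using commutator_filtration.one[OF commutator_filtration_axioms] by blast
next
  case (incl h)
  then show ?case using commutator by blast
next
  case (inv h)
  then show ?case using commutator inverse by blast
next
  case (eng h1 h2)
  then show ?case using mult by blast
qed

lemma level_of_int_power:
  assumes "(n, g) \<in> F"
  shows "(n * nat \<bar>i\<bar>, g [^] i) \<in> F"
proof -
  have nat_power: "(n * j, g [^] j) \<in> F" for j :: nat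
  proof (induction j)
    case 0
    show ?case by (simp add: one)
  next
    case (Suc j)
    show ?case using mult[OF Suc assms] by (simp add: add.commute)
  qed
  show ?thesis
  proof (cases i rule: int_cases2)
    case (nonneg j)
    then show ?thesis using nat_power[of j] by (simp add: int_pow_int)
  next
    case (nonpos j)
    then show ?thesis
      using inverse[OF nat_power[of j]] closed[OF assms] by (simp add: int_pow_neg int_pow_int)
  qed
qed

text \<open>
  The exponents that put \<open>x\<close> into the support form a subgroup of the integers.  If it is trivial,
  only the identity has to be considered.  Otherwise it is generated by some \<open>k > 0\<close>, and the level
  of the single element \<open>x\<^sup>k\<close> serves as the slope.
\<close>

lemma linear_level_of_powers:
  assumes x: "x \<in> carrier G"
  obtains s where
    "\<And>i n. (\<exists>m. (m, x [^] (i::int)) \<in> F) \<Longrightarrow> \<bar>i\<bar> \<le> int n \<Longrightarrow> (s * n, x [^] i) \<in> F"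
proof (cases "\<exists>k::nat. 0 < k \<and> (\<exists>m. (m, x [^] int k) \<in> F)")
  case False
  have "i = 0" if i: "\<exists>m. (m, x [^] i) \<in> F" for i :: int
  proof (rule ccontr)
    assume "i \<noteq> 0"
    have "\<exists>m. (m, x [^] (- i)) \<in> F"
      using i inverse x by (metis int_pow_neg)
    with i have "\<exists>m. (m, x [^] int (nat \<bar>i\<bar>)) \<in> F"
      by (cases "0 \<le> i") auto
    with False \<open>i \<noteq> 0\<close> show False by (metis zero_less_nat_eq zero_less_abs_iff)
  qed
  then show thesis using that[of 0] one by fastforce
next
  case True
  define k where "k = (LEAST k::nat. 0 < k \<and> (\<exists>m. (m, x [^] int k) \<in> F))"
  have k: "0 < k" "\<exists>m. (m, x [^] int k) \<in> F"
    using LeastI_ex[OF True] unfolding k_def by auto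
  have least: "k \<le> l" if "0 < l" "\<exists>m. (m, x [^] int l) \<in> F" for l
    using that unfolding k_def by (blast intro: Least_le)
  obtain s where s: "(s, x [^] int k) \<in> F" using k by blast
  have "(s * n, x [^] i) \<in> F" if i: "\<exists>m. (m, x [^] i) \<in> F" and n: "\<bar>i\<bar> \<le> int n" for i :: int and n
  proof -
    define j r where "j = i div int k" and "r = i mod int k"
    have ijr: "i = int k * j + r" by (simp add: j_def r_def)
    have r: "0 \<le> r" "r < int k" using k by (auto simp: r_def)
    have kj: "(s * nat \<bar>j\<bar>, x [^] (int k * j)) \<in> F"
      using level_of_int_power[OF s, of j] x by (simp add: int_pow_pow)
    have "x [^] r = inv (x [^] (int k * j)) \<otimes> x [^] i"
      using x by (simp add: ijr int_pow_mult flip: m_assoc)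
    then have "\<exists>m. (m, x [^] int (nat r)) \<in> F"
      using i mult[OF inverse[OF kj]] r by auto
    then have "r = 0" using least[of "nat r"] r by fastforce
    with ijr have i_eq: "i = int k * j" by simp
    have "\<bar>j\<bar> \<le> \<bar>i\<bar>"
      using k unfolding i_eq abs_mult by (simp add: mult_le_cancel_right1)
    with n have "nat \<bar>j\<bar> \<le> n" by linarith
    then show ?thesis using level_mono[OF kj] i_eq by simp
  qed
  then show thesis by (rule that)
qed

text \<open>
  The new filtration puts \<open>g\<close> at level \<open>m + s * k\<close> if every conjugate of \<open>g\<close> differs from one and
  the same power of \<open>x\<close>, of exponent at most \<open>k\<close>, by an element of the old level \<open>m\<close>.  Quantifying
  over all conjugates makes conjugation invariance automatic.  The element \<open>x\<close> itself enters at
  level \<open>1 + s\<close>, since its conjugates differ from it by a commutator.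
\<close>

lemma exists_extension_containing:
  assumes x: "x \<in> carrier G"
  obtains F' N where "commutator_filtration G F'" "F \<subseteq> F'" "(N, x) \<in> F'"
proof -
  obtain s where s:
    "\<And>i n. (\<exists>m. (m, x [^] (i::int)) \<in> F) \<Longrightarrow> \<bar>i\<bar> \<le> int n \<Longrightarrow> (s * n, x [^] i) \<in> F"
    using linear_level_of_powers[OF x] by blast
  define near where "near m i g \<longleftrightarrow> g \<in> carrier G \<and>
      (\<forall>u\<in>carrier G. (m, u \<otimes> g \<otimes> inv u \<otimes> inv (x [^] i)) \<in> F)" for m g and i :: int
  define F' where "F' = {(m + s * k, g) | m k g. \<exists>i::int. \<bar>i\<bar> \<le> int k \<and> near m i g}"
  have F'I: "(N, g) \<in> F'" if "near m i g" "\<bar>i\<bar> \<le> int k" "N = m + s * k" for N m k i g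
    unfolding F'_def mem_Collect_eq using that by (intro exI[of _ m] exI[of _ k] exI[of _ g]) auto
  have F'E: "\<exists>m k i. near m i g \<and> \<bar>i\<bar> \<le> int k \<and> N = m + s * k" if "(N, g) \<in> F'" for N g
    using that unfolding F'_def mem_Collect_eq prod.inject by metis
  have pow: "x [^] i \<in> carrier G" for i :: int using x by simp
  have nearD: "g \<in> carrier G" "u \<in> carrier G \<Longrightarrow> (m, u \<otimes> g \<otimes> inv u \<otimes> inv (x [^] i)) \<in> F"
    if "near m i g" for m i g u
    using that unfolding near_def by auto
  have near_F: "near m 0 g" if "(m, g) \<in> F" for m g
    using that closed conjugate unfolding near_def by simp
  have F_sub: "F \<subseteq> F'"
  proof (rule subrelI)
    fix n g assume "(n, g) \<in> F"
    then show "(n, g) \<in> F'" by (intro F'I[of n 0 g 0]) (simp_all add: near_F)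
  qed
  have "near 1 1 x"
    using commutator[OF _ x] x unfolding near_def by simp
  then have x_in: "(1 + s, x) \<in> F'"
    by (rule F'I[of _ _ _ 1]) auto
  have "commutator_filtration G F'"
  proof unfold_locales
    fix N g assume "(N, g) \<in> F'"
    then obtain m k i where g: "near m i g" "\<bar>i\<bar> \<le> int k" "N = m + s * k" using F'E by blast
    note gc = nearD(1)[OF g(1)]
    show "g \<in> carrier G" by (rule gc)
    show "(N, inv g) \<in> F'"
    proof (rule F'I[OF _ _ g(3)])
      show "\<bar>- i\<bar> \<le> int k" using g by simp
      show "near m (- i) (inv g)"
        unfolding near_def
      proof (intro conjI ballI)
        show "inv g \<in> carrier G" using gc by simp
        fix u assume u: "u \<in> carrier G"
        define y where "y = u \<otimes> g \<otimes> inv u"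
        have y: "y \<in> carrier G" using u gc by (simp add: y_def)
        have "(m, inv (inv (x [^] i) \<otimes> (y \<otimes> inv (x [^] i)) \<otimes> inv (inv (x [^] i)))) \<in> F"
          using nearD(2)[OF g(1) u] pow by (intro inverse conjugate) (simp_all add: y_def)
        moreover have "inv (inv (x [^] i) \<otimes> (y \<otimes> inv (x [^] i)) \<otimes> inv (inv (x [^] i)))
            = inv y \<otimes> inv (x [^] (- i))"
          using y pow x by (simp add: m_assoc inv_mult_group int_pow_neg)
        moreover have "inv y = u \<otimes> inv g \<otimes> inv u"
          unfolding y_def using u gc by (simp add: conjugate_inv)
        ultimately show "(m, u \<otimes> inv g \<otimes> inv u \<otimes> inv (x [^] (- i))) \<in> F" by simp
      qed
    qed
    show "(N, v \<otimes> g \<otimes> inv v) \<in> F'" if v: "v \<in> carrier G" for v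
    proof (rule F'I[OF _ g(2,3)])
      have "u \<otimes> (v \<otimes> g \<otimes> inv v) \<otimes> inv u = (u \<otimes> v) \<otimes> g \<otimes> inv (u \<otimes> v)"
        if "u \<in> carrier G" for u
        using that v gc by (simp add: m_assoc inv_mult_group)
      then show "near m i (v \<otimes> g \<otimes> inv v)"
        using nearD(2)[OF g(1)] v gc unfolding near_def by simp
    qed
    show "commutator_length G g \<le> N" if g_derived: "g \<in> derived G (carrier G)"
    proof -
      have gx: "(m, g \<otimes> inv (x [^] i)) \<in> F"
        using nearD(2)[OF g(1) one_closed] gc by simp
      \<comment> \<open>Since \<open>g\<close> is in the support of \<open>F\<close>, so is \<open>x\<^sup>i\<close>, and the choice of \<open>s\<close> applies.\<close>
      obtain n where n: "(n, g) \<in> F" using derived_in_support[OF g_derived] by blast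
      have "inv (g \<otimes> inv (x [^] i)) \<otimes> g = x [^] i"
        using gc pow by (simp add: inv_mult_group m_assoc)
      then have "\<exists>m. (m, x [^] i) \<in> F"
        using mult[OF inverse[OF gx] n] by auto
      from mult[OF gx s[OF this g(2)]] have "(N, g) \<in> F"
        using gc pow g(3) by (simp add: m_assoc)
      then show ?thesis using g_derived by (rule commutator_length_le)
    qed
    fix N' g' assume "(N', g') \<in> F'"
    then obtain m' k' i' where g': "near m' i' g'" "\<bar>i'\<bar> \<le> int k'" "N' = m' + s * k'"
      using F'E by blast
    note gc' = nearD(1)[OF g'(1)]
    show "(N + N', g \<otimes> g') \<in> F'"
    proof (rule F'I[of "m + m'" "i + i'" _ "k + k'"])
      show "\<bar>i + i'\<bar> \<le> int (k + k')" using g(2) g'(2) by simp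
      show "N + N' = m + m' + s * (k + k')" using g(3) g'(3) by (simp add: algebra_simps)
      show "near (m + m') (i + i') (g \<otimes> g')"
        unfolding near_def
      proof (intro conjI ballI)
        show "g \<otimes> g' \<in> carrier G" using gc gc' by simp
        fix u assume u: "u \<in> carrier G"
        define y where "y = u \<otimes> g \<otimes> inv u"
        define y' where "y' = u \<otimes> g' \<otimes> inv u"
        have y: "y \<in> carrier G" "y' \<in> carrier G" using u gc gc' by (simp_all add: y_def y'_def)
        \<comment> \<open>The power \<open>x\<^sup>i\<close> is moved past the second deviation by conjugating the latter with it.\<close>
        have "(m + m', y \<otimes> inv (x [^] i) \<otimes> (x [^] i \<otimes> (y' \<otimes> inv (x [^] i')) \<otimes> inv (x [^] i))) \<in> F"
          using nearD(2)[OF g(1) u] nearD(2)[OF g'(1) u] pow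
          by (intro mult conjugate) (simp_all add: y_def y'_def)
        moreover have "y \<otimes> inv (x [^] i) \<otimes> (x [^] i \<otimes> (y' \<otimes> inv (x [^] i')) \<otimes> inv (x [^] i))
            = y \<otimes> y' \<otimes> (inv (x [^] i') \<otimes> inv (x [^] i))"
        proof -
          have "inv (x [^] i) \<otimes> (x [^] i \<otimes> z) = z" if "z \<in> carrier G" for z
            using pow that by (simp flip: m_assoc)
          then show ?thesis using y pow by (simp add: m_assoc)
        qed
        moreover have "inv (x [^] i') \<otimes> inv (x [^] i) = inv (x [^] (i + i'))"
          using x pow by (simp add: int_pow_mult inv_mult_group)
        moreover have "y \<otimes> y' = u \<otimes> (g \<otimes> g') \<otimes> inv u"
          unfolding y_def y'_def using u gc gc' by (simp add: conjugate_mult)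
        ultimately show "(m + m', u \<otimes> (g \<otimes> g') \<otimes> inv u \<otimes> inv (x [^] (i + i'))) \<in> F" by simp
      qed
    qed
  qed (use F_sub one commutator in auto)
  then show thesis using that F_sub x_in by blast
qed

end

section \<open>Maximal filtrations and the resulting norm\<close>

lemma union_of_chain_is_filtration:
  assumes "C \<noteq> {}" "subset.chain {F. commutator_filtration G F} C"
  shows "commutator_filtration G (\<Union>C)"
proof -
  have filtration: "commutator_filtration G F" if "F \<in> C" for F
    using assms(2) that unfolding subset.chain_def by blast
  obtain F0 where F0: "F0 \<in> C" using assms(1) by blast
  interpret F0: commutator_filtration G F0 using filtration[OF F0] .
  show ?thesis
  proof unfold_locales
    fix m f n g assume "(m, f) \<in> \<Union>C" "(n, g) \<in> \<Union>C"
    then obtain A B where AB: "A \<in> C" "(m, f) \<in> A" "B \<in> C" "(n, g) \<in> B" by blast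
    then have "A \<subseteq> B \<or> B \<subseteq> A"
      using assms(2) unfolding subset_chain_def by blast
    then obtain D where D: "D \<in> C" "(m, f) \<in> D" "(n, g) \<in> D" using AB by blast
    from commutator_filtration.mult[OF filtration[OF D(1)] D(2,3)] D(1)
    show "(m + n, f \<otimes>\<^bsub>G\<^esub> g) \<in> \<Union>C" by blast
  next
    fix n g assume "(n, g) \<in> \<Union>C"
    then obtain A where A: "A \<in> C" "(n, g) \<in> A" by blast
    interpret A: commutator_filtration G A using filtration[OF A(1)] .
    show "g \<in> carrier G" using A.closed A(2) .
    show "(n, inv\<^bsub>G\<^esub> g) \<in> \<Union>C" using A.inverse A by blast
    show "(n, u \<otimes>\<^bsub>G\<^esub> g \<otimes>\<^bsub>G\<^esub> inv\<^bsub>G\<^esub> u) \<in> \<Union>C" if "u \<in> carrier G" for u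
      using A.conjugate A that by blast
    show "commutator_length G g \<le> n" if "g \<in> derived G (carrier G)"
      using A.commutator_length_le[OF A(2) that] .
  qed (use F0 F0.one F0.commutator in blast)+
qed

lemma (in group) exists_exhausting_filtration:
  obtains F where "commutator_filtration G F" "\<And>g. g \<in> carrier G \<Longrightarrow> \<exists>n. (n, g) \<in> F"
proof -
  have "\<exists>F\<in>{F. commutator_filtration G F}. \<forall>F'\<in>{F. commutator_filtration G F}. F \<subseteq> F' \<longrightarrow> F' = F"
    using commutator_products_filtration
    by (intro subset_Zorn_nonempty) (auto intro: union_of_chain_is_filtration)
  then obtain F where F: "commutator_filtration G F"
    and maximal: "\<And>F'. commutator_filtration G F' \<Longrightarrow> F \<subseteq> F' \<Longrightarrow> F' = F"
    by blast
  have "\<exists>n. (n, g) \<in> F" if "g \<in> carrier G" for g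
    using commutator_filtration.exists_extension_containing[OF F that] maximal by metis
  with F show thesis by (rule that)
qed

text \<open>
  The level function of an exhausting filtration has all properties of a norm except that it may
  vanish at nontrivial elements; adding \<open>1\<close> away from the identity repairs this.
\<close>

lemma (in commutator_filtration) exists_norm_above_commutator_length:
  assumes exhausting: "\<And>g. g \<in> carrier G \<Longrightarrow> \<exists>n. (n, g) \<in> F"
  obtains \<nu> where "conj_inv_norm G \<nu>"
    "\<And>g. g \<in> derived G (carrier G) \<Longrightarrow> real (commutator_length G g) \<le> \<nu> g"
proof -
  define level where "level g = (LEAST n. (n, g) \<in> F)" for g
  have level: "(level g, g) \<in> F" if "g \<in> carrier G" for g
    using LeastI_ex[OF exhausting[OF that]] unfolding level_def .
  have level_le: "level g \<le> n" if "(n, g) \<in> F" for n g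
    using that unfolding level_def by (rule Least_le)
  define \<nu> where "\<nu> g = real (level g + (if g = \<one> then 0 else 1))" for g
  have level_inv_le: "level (inv g) \<le> level g" if "g \<in> carrier G" for g
    using level_le[OF inverse[OF level[OF that]]] .
  have level_conj_le: "level (u \<otimes> g \<otimes> inv u) \<le> level g"
    if "g \<in> carrier G" "u \<in> carrier G" for g u
    using level_le[OF conjugate[OF level]] that by blast
  have "conj_inv_norm G \<nu>"
    unfolding conj_inv_norm_def
  proof (intro conjI ballI impI)
    show "\<nu> \<one> = 0" using level_le[OF one[of 0]] by (simp add: \<nu>_def)
    fix f assume f: "f \<in> carrier G"
    show "0 \<le> \<nu> f" by (simp add: \<nu>_def)
    show "0 < \<nu> f" if "f \<noteq> \<one>" using that by (simp add: \<nu>_def)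
    have "level (inv f) = level f"
      using level_inv_le[of f] level_inv_le[of "inv f"] f by simp
    then show "\<nu> (inv f) = \<nu> f" using f by (simp add: \<nu>_def inv_eq_1_iff)
    fix g assume g: "g \<in> carrier G"
    have "level (f \<otimes> g) \<le> level f + level g"
      by (intro level_le mult level f g)
    then show "\<nu> (f \<otimes> g) \<le> \<nu> f + \<nu> g" using f g by (auto simp: \<nu>_def)
    have conjugate_back: "inv g \<otimes> (g \<otimes> f \<otimes> inv g) \<otimes> inv (inv g) = f"
    proof -
      have "inv g \<otimes> (g \<otimes> f) = f" using f g by (simp flip: m_assoc)
      then show ?thesis using f g by (simp add: m_assoc)
    qed
    have "level (g \<otimes> f \<otimes> inv g) = level f"
      using level_conj_le[of f g] level_conj_le[of "g \<otimes> f \<otimes> inv g" "inv g"]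
        conjugate_back f g by simp
    moreover have "g \<otimes> f \<otimes> inv g = \<one> \<longleftrightarrow> f = \<one>"
      using conjugate_back f g by (metis inv_closed inv_inv r_inv r_one)
    ultimately show "\<nu> (g \<otimes> f \<otimes> inv g) = \<nu> f" by (simp add: \<nu>_def)
  qed
  moreover have "real (commutator_length G g) \<le> \<nu> g" if "g \<in> derived G (carrier G)" for g
  proof -
    have "g \<in> carrier G"
      using that derived_in_carrier[OF subset_refl] by blast
    then have "commutator_length G g \<le> level g"
      using commutator_length_le[OF level that] by simp
    then show ?thesis by (simp add: \<nu>_def)
  qed
  ultimately show thesis by (rule that)
qed

theorem proposition1p4:
  fixes G :: "('a, 'b) monoid_scheme"
  assumes "group G"
    and "\<not> (\<exists>C. \<forall>g\<in>derived G (carrier G). commutator_length G g \<le> C)"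
  shows "\<not> bounded_group G"
proof
  assume bounded: "bounded_group G"
  interpret group G by fact
  obtain F where F: "commutator_filtration G F" "\<And>g. g \<in> carrier G \<Longrightarrow> \<exists>n. (n, g) \<in> F"
    using exists_exhausting_filtration by blast
  obtain \<nu> where \<nu>: "conj_inv_norm G \<nu>"
    "\<And>g. g \<in> derived G (carrier G) \<Longrightarrow> real (commutator_length G g) \<le> \<nu> g"
    using commutator_filtration.exists_norm_above_commutator_length[OF F] by blast
  obtain C where C: "\<And>g. g \<in> carrier G \<Longrightarrow> \<nu> g \<le> C"
    using bounded \<nu>(1) unfolding bounded_group_iff_norm by blast
  have "commutator_length G g \<le> nat \<lceil>C\<rceil>" if "g \<in> derived G (carrier G)" for g
  proof -
    have "g \<in> carrier G" using that derived_in_carrier[OF subset_refl] by blast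
    with C \<nu>(2)[OF that] have "real (commutator_length G g) \<le> C" by fastforce
    then show ?thesis by linarith
  qed
  with assms(2) show False by blast
qed

end
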